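(* Let $\eta,\eta'\in\Omega^*$. Then $\nu_{\eta'}\prec\nu_{\eta}$ if and only if $\eta'\in\overline{o}_-(\eta)$.
   Context: $\mathbb{N}=\{1,2,3,\dots\}$, $\beta\mathbb{N}$ is its Stone–Čech compactification and $\mathbb{N}^*=\beta\mathbb{N}\setminus\mathbb{N}$, whose points are the free ultrafilters on $\mathbb{N}$. Let $\tau:\beta\mathbb{N}\to\beta\mathbb{N}$ be the continuous extension of $n\mapsto n+1$; its restriction to $\mathbb{N}^*$ is a homeomorphism of $\mathbb{N}^*$ onto itself. $\Omega^*$ is the quotient space of $\mathbb{N}^*\times[0,1]$ obtained by identifying $(\omega,1)$ with $(\tau\omega,0)$ for all $\omega\in\mathbb{N}^*$. For $s\in\mathbb{R}$, the homeomorphism $\phi^s:\Omega^*\to\Omega^*$ is $\phi^s(\omega,t)=(\tau^{[t+s]}\omega,\ t+s-[t+s])$, where $[x]$ is the largest integer not exceeding $x$. Put $o_-(\eta)=\{\phi^{-s}(\eta): s\ge 0\}$ and let $\overline{o}_-(\eta)$ be its closure in $\Omega^*$. For $\eta=(\omega,t)\in\Omega^*$, with $\theta=2^t$, $\nu_\eta$ is the finitely additive probability measure on $\mathcal{P}(\mathbb{N})$ given by $\nu_\eta(A)=\omega\text{-}\lim_n \frac{|A\cap\{1,\dots,[\theta\cdot 2^n]\}|}{\theta\cdot 2^n}$, the limit being taken along the ultrafilter $\omega$. For finitely additive probability measures $\mu,\nu$ on $\mathcal{P}(\mathbb{N})$, $\nu\prec\mu$ ($\nu$ is weakly absolutely continuous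 with respect to $\mu$) means that for all $A\in\mathcal{P}(\mathbb{N})$, $\mu(A)=0$ implies $\nu(A)=0$. *)

theory Defs
  imports "HOL-Analysis.Analysis"
begin

section \<open>Ultrafilters\<close>

definition is_ultrafilter :: "'a filter \<Rightarrow> bool" where
  "is_ultrafilter F \<longleftrightarrow>
     F \<noteq> bot \<and> (\<forall>P. eventually P F \<or> eventually (\<lambda>x. \<not> P x) F)"

lemma ultrafilter_not_iff:
  assumes "is_ultrafilter F"
  shows "eventually (\<lambda>x. \<not> P x) F \<longleftrightarrow> \<not> eventually P F"
proof -
  have "False" if "eventually P F" "eventually (\<lambda>x. \<not> P x) F"
  proof -
    have "eventually (\<lambda>x. False) F" using eventually_conj[OF that] by simp
    then show False using assms by (simp add: is_ultrafilter_def trivial_limit_def)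
  qed
  then show ?thesis using assms unfolding is_ultrafilter_def by blast
qed

lemma ex_ultrafilter_le:
  fixes F :: "'a filter"
  assumes "F \<noteq> bot"
  shows "\<exists>G. is_ultrafilter G \<and> G \<le> F"
proof -
  define A where "A = {G :: 'a filter. G \<noteq> bot \<and> G \<le> F}"
  have po: "partial_order_on A (relation_of (\<ge>) A)"
    by (rule partial_order_on_relation_ofI) auto
  have ch: "\<exists>u\<in>A. \<forall>a\<in>C. a \<ge> u" if C: "C \<in> Chains (relation_of (\<ge>) A)" for C
  proof (cases "C = {}")
    case True
    then show ?thesis using assms by (auto simp: A_def)
  next
    case False
    have CA: "C \<subseteq> A" and tot: "\<And>a b. a \<in> C \<Longrightarrow> b \<in> C \<Longrightarrow> a \<le> b \<or> b \<le> a"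
      using C by (auto simp: Chains_def relation_of_def)
    have fin: "\<exists>m\<in>C. \<forall>x\<in>X. m \<le> x" if "finite X" "X \<subseteq> C" for X
      using that
    proof (induction X rule: finite_induct)
      case empty
      then show ?case using False by auto
    next
      case (insert x X)
      then obtain m where m: "m \<in> C" "\<forall>y\<in>X. m \<le> y" by auto
      have "m \<le> x \<or> x \<le> m" using tot[OF m(1), of x] insert.prems by auto
      then show ?case
      proof
        assume "m \<le> x" then show ?thesis using m by auto
      next
        assume "x \<le> m" then show ?thesis using m insert.prems
          by (intro bexI[of _ x]) (auto intro: order_trans)
      qed
    qed
    have "Inf C \<noteq> bot"
    proof (rule Inf_filter_not_bot)
      fix X assume "X \<subseteq> C" "finite X"
      then obtain m where m: "m \<in> C" "\<forall>x\<in>X. m \<le> x" using fin by blast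
      then have "m \<le> Inf X" by (auto intro: Inf_greatest)
      moreover have "m \<noteq> bot" using m(1) CA by (auto simp: A_def)
      ultimately show "Inf X \<noteq> bot" by (auto simp: bot_unique)
    qed
    moreover have "Inf C \<le> F"
      using False CA by (auto simp: A_def intro: Inf_lower2)
    ultimately show ?thesis
      by (intro bexI[of _ "Inf C"]) (auto simp: A_def intro: Inf_lower)
  qed
  obtain G where G: "G \<in> A" and max: "\<And>H. H \<in> A \<Longrightarrow> H \<le> G \<Longrightarrow> H = G"
    using predicate_Zorn[OF po ch] by blast
  have "eventually P G \<or> eventually (\<lambda>x. \<not> P x) G" for P
  proof (rule disjCI)
    assume *: "\<not> eventually (\<lambda>x. \<not> P x) G"
    let ?H = "inf G (principal {x. P x})"
    have "?H \<noteq> bot" using * by (simp add: trivial_limit_def eventually_inf_principal)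
    then have "?H = G"
      using G by (intro max) (auto simp: A_def intro: le_infI1)
    moreover have "eventually P ?H" by (simp add: eventually_inf_principal)
    ultimately show "eventually P G" by simp
  qed
  then show ?thesis using G by (auto simp: A_def is_ultrafilter_def)
qed

lemma is_ultrafilter_filtermap: "is_ultrafilter F \<Longrightarrow> is_ultrafilter (filtermap f F)"
  by (auto simp: is_ultrafilter_def eventually_filtermap filtermap_bot_iff)

lemma is_ultrafilter_principal: "is_ultrafilter (principal {x})"
  by (auto simp: is_ultrafilter_def eventually_principal principal_eq_bot_iff)

lemma ultrafilter_tendsto_compact:
  fixes f :: "'a \<Rightarrow> 'b::topological_space"
  assumes F: "is_ultrafilter F" and K: "compact K" and ev: "eventually (\<lambda>x. f x \<in> K) F"
  shows "\<exists>l\<in>K. (f \<longlongrightarrow> l) F"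
proof -
  have "filtermap f F \<noteq> bot" using F by (simp add: is_ultrafilter_def filtermap_bot_iff)
  moreover have "eventually (\<lambda>y. y \<in> K) (filtermap f F)" using ev by (simp add: eventually_filtermap)
  ultimately obtain l where l: "l \<in> K" "inf (nhds l) (filtermap f F) \<noteq> bot"
    using K unfolding compact_filter by blast
  have "eventually (\<lambda>x. f x \<in> S) F" if S: "open S" "l \<in> S" for S
  proof (rule ccontr)
    assume "\<not> ?thesis"
    then have "eventually (\<lambda>x. f x \<notin> S) F" using ultrafilter_not_iff[OF F] by blast
    then have "eventually (\<lambda>y. y \<notin> S) (filtermap f F)" by (simp add: eventually_filtermap)
    moreover have "eventually (\<lambda>y. y \<in> S) (nhds l)" using S by (simp add: eventually_nhds_in_open)
    ultimately have "eventually (\<lambda>y. False) (inf (nhds l) (filtermap f F))"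
      unfolding eventually_inf by fastforce
    then show False using l(2) by (simp add: trivial_limit_def)
  qed
  then show ?thesis using l(1) by (auto simp: tendsto_def)
qed


section \<open>The Stone--Cech compactification of the positive integers\<close>

text \<open>The set \<open>{1, 2, 3, \<dots>}\<close> is \<^term>\<open>{1..} :: nat set\<close>. An ultrafilter on it is
  represented by the ultrafilter on \<^typ>\<open>nat\<close> that it generates, that is, by an ultrafilter
  on \<^typ>\<open>nat\<close> containing \<^term>\<open>{1..} :: nat set\<close>.\<close>

typedef betaN = "{F :: nat filter. is_ultrafilter F \<and> eventually (\<lambda>n. n \<ge> 1) F}"
  morphisms ultra Abs_betaN
  by (intro exI[of _ "principal {1}"]) (simp add: is_ultrafilter_principal eventually_principal)

setup_lifting type_definition_betaN

lemma ultra_ultrafilter: "is_ultrafilter (ultra \<omega>)"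
  and ultra_ge_1: "eventually (\<lambda>n. n \<ge> 1) (ultra \<omega>)"
  using ultra[of \<omega>] by auto

lemma ultra_neq_bot: "ultra \<omega> \<noteq> bot"
  using ultra_ultrafilter[of \<omega>] by (simp add: is_ultrafilter_def)

text \<open>The topology with the sets \<open>{\<xi>. A \<in> \<xi>}\<close>, for \<open>A\<close> a set of positive integers,
  as a base.\<close>

instantiation betaN :: t2_space
begin

definition open_betaN :: "betaN set \<Rightarrow> bool" where
  "open_betaN U \<longleftrightarrow>
     (\<forall>\<omega>\<in>U. \<exists>A\<subseteq>{1..}. (\<forall>\<^sub>F n in ultra \<omega>. n \<in> A) \<and> {\<xi>. \<forall>\<^sub>F n in ultra \<xi>. n \<in> A} \<subseteq> U)"

instance
proof
  show "open (UNIV :: betaN set)"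
    unfolding open_betaN_def by (auto intro!: exI[of _ "{1..}"] simp: ultra_ge_1[simplified])
next
  fix U V :: "betaN set"
  assume U: "open U" and V: "open V"
  show "open (U \<inter> V)"
    unfolding open_betaN_def
  proof
    fix \<omega> assume "\<omega> \<in> U \<inter> V"
    then obtain A B where "A \<subseteq> {1..}" "\<forall>\<^sub>F n in ultra \<omega>. n \<in> A" "{\<xi>. \<forall>\<^sub>F n in ultra \<xi>. n \<in> A} \<subseteq> U"
      "B \<subseteq> {1..}" "\<forall>\<^sub>F n in ultra \<omega>. n \<in> B" "{\<xi>. \<forall>\<^sub>F n in ultra \<xi>. n \<in> B} \<subseteq> V"
      using U V unfolding open_betaN_def by (metis IntD1 IntD2)
    then show "\<exists>A\<subseteq>{1..}. (\<forall>\<^sub>F n in ultra \<omega>. n \<in> A) \<and> {\<xi>. \<forall>\<^sub>F n in ultra \<xi>. n \<in> A} \<subseteq> U \<inter> V"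
      by (intro exI[of _ "A \<inter> B"]) (auto simp: eventually_conj_iff)
  qed
next
  fix K :: "betaN set set"
  assume "\<forall>U\<in>K. open U"
  then show "open (\<Union>K)" unfolding open_betaN_def by (meson Sup_upper UnionE order_trans)
next
  fix \<omega> \<xi> :: betaN
  assume "\<omega> \<noteq> \<xi>"
  then have "ultra \<omega> \<noteq> ultra \<xi>" by (simp add: ultra_inject)
  then obtain P where P: "eventually P (ultra \<omega>) \<noteq> eventually P (ultra \<xi>)"
    by (auto simp: filter_eq_iff)
  obtain Q where Q: "eventually Q (ultra \<omega>)" "\<not> eventually Q (ultra \<xi>)"
  proof (cases "eventually P (ultra \<omega>)")
    case True
    then show ?thesis using P that by blast
  next
    case False
    then show ?thesis using P that[of "\<lambda>n. \<not> P n"] ultrafilter_not_iff[OF ultra_ultrafilter] by blast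
  qed
  define W where "W = (\<lambda>A. {\<zeta>. \<forall>\<^sub>F n in ultra \<zeta>. n \<in> A})"
  have opn: "open (W A)" if "A \<subseteq> {1..}" for A using that by (auto simp: open_betaN_def W_def)
  let ?A = "{n. n \<ge> 1 \<and> Q n}" and ?B = "{n. n \<ge> 1 \<and> \<not> Q n}"
  have "\<omega> \<in> W ?A" "\<xi> \<in> W ?B"
    using Q ultra_ge_1 ultrafilter_not_iff[OF ultra_ultrafilter]
    by (auto simp: W_def eventually_conj_iff)
  moreover have "W ?A \<inter> W ?B = {}"
    using ultrafilter_not_iff[OF ultra_ultrafilter]
    by (auto simp: W_def eventually_conj_iff)
  moreover have "open (W ?A)" "open (W ?B)" by (auto intro!: opn)
  ultimately show "\<exists>U V. open U \<and> open V \<and> \<omega> \<in> U \<and> \<xi> \<in> V \<and> U \<inter> V = {}" by blast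
qed

end

definition embN :: "nat \<Rightarrow> betaN" where
  "embN n = Abs_betaN (principal {n})"

lemma ultra_embN: "n \<ge> 1 \<Longrightarrow> ultra (embN n) = principal {n}"
  unfolding embN_def
  by (rule Abs_betaN_inverse) (simp add: is_ultrafilter_principal eventually_principal)

lemma inj_on_embN: "inj_on embN {1..}"
  by (rule inj_onI) (metis atLeast_iff principal_inject singleton_inject ultra_embN)

lemma open_betaN_basic: "open {\<xi>. eventually P (ultra \<xi>)}"
  unfolding open_betaN_def
proof clarify
  fix \<omega> assume "eventually P (ultra \<omega>)"
  then show "\<exists>A\<subseteq>{1..}. (\<forall>\<^sub>F n in ultra \<omega>. n \<in> A) \<and>
      {\<xi>. \<forall>\<^sub>F n in ultra \<xi>. n \<in> A} \<subseteq> {\<xi>. eventually P (ultra \<xi>)}"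
    using ultra_ge_1[of \<omega>]
    by (intro exI[of _ "{n. n \<ge> 1 \<and> P n}"]) (auto simp: eventually_conj_iff)
qed

lemma open_embN: "n \<ge> 1 \<Longrightarrow> open {embN n}"
proof -
  assume n: "n \<ge> 1"
  have "{\<xi>. \<forall>\<^sub>F m in ultra \<xi>. m \<in> {n}} = {embN n}"
  proof (intro set_eqI iffI)
    fix \<xi> assume "\<xi> \<in> {\<xi>. \<forall>\<^sub>F m in ultra \<xi>. m \<in> {n}}"
    then have "ultra \<xi> \<le> principal {n}" by (simp add: le_principal)
    moreover have "principal {n} \<le> ultra \<xi>"
    proof (rule filter_leI)
      fix P assume P: "eventually P (ultra \<xi>)"
      have "eventually (\<lambda>m. P m \<and> m = n) (ultra \<xi>)"
        using P \<open>\<xi> \<in> _\<close> by (simp add: eventually_conj_iff)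
      then have "\<exists>m. P m \<and> m = n" using eventually_happens' ultra_neq_bot by blast
      then show "eventually P (principal {n})" by (simp add: eventually_principal)
    qed
    ultimately show "\<xi> \<in> {embN n}" using ultra_embN[OF n] by (simp add: ultra_inject[symmetric])
  qed (auto simp: ultra_embN[OF n] eventually_principal)
  then show ?thesis using open_betaN_basic[of "\<lambda>m. m \<in> {n}"] by simp
qed

lemma dense_embN: "closure (embN ` {1..}) = UNIV"
proof -
  have "\<omega> \<in> closure (embN ` {1..})" for \<omega>
    unfolding closure_iff_nhds_not_empty
  proof (intro allI impI)
    fix A U assume "U \<subseteq> A" "open U" "\<omega> \<in> U"
    then obtain B where B: "B \<subseteq> {1..}" "\<forall>\<^sub>F n in ultra \<omega>. n \<in> B" "{\<xi>. \<forall>\<^sub>F n in ultra \<xi>. n \<in> B} \<subseteq> U"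
      unfolding open_betaN_def by blast
    then obtain n where n: "n \<in> B" using eventually_happens' ultra_neq_bot by blast
    then have n1: "n \<ge> 1" using B(1) by auto
    then have "embN n \<in> U" using B(3) n by (auto simp: ultra_embN eventually_principal)
    then show "embN ` {1..} \<inter> A \<noteq> {}" using n1 \<open>U \<subseteq> A\<close> by auto
  qed
  then show ?thesis by auto
qed

lemma compact_betaN: "compact (UNIV :: betaN set)"
  unfolding compact_filter
proof (intro allI impI)
  fix F :: "betaN filter" assume "F \<noteq> bot"
  then obtain G where G: "is_ultrafilter G" "G \<le> F" using ex_ultrafilter_le by blast
  define \<Phi> where "\<Phi> = Abs_filter (\<lambda>P. \<forall>\<^sub>F \<omega> in G. eventually P (ultra \<omega>))"
  have "is_filter (\<lambda>P. \<forall>\<^sub>F \<omega> in G. eventually P (ultra \<omega>))"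
    by (rule is_filter.intro)
      (auto simp: eventually_conj_iff elim: eventually_mono intro: eventually_mono[OF _ eventually_mono])
  then have ev: "eventually P \<Phi> \<longleftrightarrow> (\<forall>\<^sub>F \<omega> in G. eventually P (ultra \<omega>))" for P
    unfolding \<Phi>_def by (rule eventually_Abs_filter)
  have nb: "G \<noteq> bot" using G by (simp add: is_ultrafilter_def)
  have "is_ultrafilter \<Phi>"
    unfolding is_ultrafilter_def trivial_limit_def ev
    using ultra_neq_bot ultrafilter_not_iff[OF ultra_ultrafilter] ultrafilter_not_iff[OF G(1)]
    by (simp add: nb)
  moreover have "eventually (\<lambda>n. n \<ge> 1) \<Phi>" unfolding ev using ultra_ge_1 by simp
  ultimately have u: "ultra (Abs_betaN \<Phi>) = \<Phi>" by (simp add: Abs_betaN_inverse)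
  let ?\<omega> = "Abs_betaN \<Phi>"
  have "G \<le> nhds ?\<omega>"
    unfolding le_nhds
  proof (intro allI impI, elim conjE)
    fix S assume "open S" "?\<omega> \<in> S"
    then obtain A where "\<forall>\<^sub>F n in \<Phi>. n \<in> A" "{\<xi>. \<forall>\<^sub>F n in ultra \<xi>. n \<in> A} \<subseteq> S"
      unfolding open_betaN_def using u by metis
    then show "\<forall>\<^sub>F \<xi> in G. \<xi> \<in> S" unfolding ev by (auto elim: eventually_mono)
  qed
  then have "G \<le> inf (nhds ?\<omega>) F" using G(2) by simp
  then have "inf (nhds ?\<omega>) F \<noteq> bot" using nb bot_unique by metis
  then show "\<exists>\<omega>\<in>UNIV. inf (nhds \<omega>) F \<noteq> bot" by blast
qed

text \<open>The universal property.\<close>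

lemma betaN_extension:
  fixes f :: "nat \<Rightarrow> 'a::t2_space"
  assumes K: "compact K" and f: "f ` {1..} \<subseteq> K"
  shows "\<exists>g. continuous_on UNIV g \<and> range g \<subseteq> K \<and> (\<forall>n\<ge>1. g (embN n) = f n)"
proof -
  have evK: "eventually (\<lambda>n. f n \<in> K) (ultra \<omega>)" for \<omega>
    by (rule eventually_mono[OF ultra_ge_1]) (use f in auto)
  define g where "g \<omega> = Lim (ultra \<omega>) f" for \<omega>
  have g: "g \<omega> \<in> K" "(f \<longlongrightarrow> g \<omega>) (ultra \<omega>)" for \<omega>
    using ultrafilter_tendsto_compact[OF ultra_ultrafilter K evK, of \<omega>] tendsto_Lim[OF ultra_neq_bot]
    unfolding g_def by metis+
  have "continuous_on UNIV g"
    unfolding continuous_on_topological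
  proof (intro ballI allI impI)
    fix \<omega> B assume B: "open B" "g \<omega> \<in> B"
    have "compact (K - B)" using K B by (intro compact_diff)
    moreover have "Hausdorff_space (euclidean :: 'a topology)"
      unfolding Hausdorff_space_def using hausdorff[where 'a = 'a] by (simp add: disjnt_def)
    moreover have "compactin euclidean {g \<omega>}" "disjnt {g \<omega>} (K - B)"
      using B(2) by (simp_all add: disjnt_def)
    ultimately have "\<exists>U V. openin euclidean U \<and> openin euclidean V \<and>
        {g \<omega>} \<subseteq> U \<and> K - B \<subseteq> V \<and> disjnt U V"
      unfolding Hausdorff_space_compact_sets by (simp only: compactin_euclidean_iff)
    then obtain U V where UV: "open U" "open V" "g \<omega> \<in> U" "K - B \<subseteq> V" "U \<inter> V = {}"
      by (auto simp: disjnt_def)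
    have 1: "\<omega> \<in> {\<xi>. eventually (\<lambda>n. f n \<in> U) (ultra \<xi>)}"
      using g(2)[of \<omega>] UV by (simp add: topological_tendstoD)
    have "g \<xi> \<in> B" if "eventually (\<lambda>n. f n \<in> U) (ultra \<xi>)" for \<xi>
    proof (rule ccontr)
      assume "g \<xi> \<notin> B"
      then have "g \<xi> \<in> V" using g(1) UV by auto
      then have "eventually (\<lambda>n. f n \<in> V) (ultra \<xi>)"
        using g(2)[of \<xi>] UV by (simp add: topological_tendstoD)
      with that have "eventually (\<lambda>n. f n \<in> U \<inter> V) (ultra \<xi>)" by (simp add: eventually_conj_iff)
      then show False using UV(5) ultra_neq_bot by simp
    qed
    then show "\<exists>A. open A \<and> \<omega> \<in> A \<and> (\<forall>y\<in>UNIV. y \<in> A \<longrightarrow> g y \<in> B)"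
      using 1 open_betaN_basic by blast
  qed
  moreover have "g (embN n) = f n" if "n \<ge> 1" for n
    unfolding g_def ultra_embN[OF that]
    by (rule tendsto_Lim) (auto simp: principal_eq_bot_iff tendsto_def eventually_principal)
  ultimately show ?thesis using g(1) by blast
qed

definition Nstar :: "betaN set" where
  "Nstar = UNIV - embN ` {1..}"

lemma Nstar_iff_free: "\<omega> \<in> Nstar \<longleftrightarrow> (\<forall>n. \<not> (\<forall>\<^sub>F m in ultra \<omega>. m = n))"
proof -
  have "\<omega> = embN n" if "\<forall>\<^sub>F m in ultra \<omega>. m = n" "n \<ge> 1" for n
  proof -
    have le: "ultra \<omega> \<le> ultra (embN n)" using that by (simp add: ultra_embN le_principal)
    have "ultra (embN n) \<le> ultra \<omega>"
    proof (rule filter_leI, rule ccontr)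
      fix P assume "eventually P (ultra \<omega>)" "\<not> eventually P (ultra (embN n))"
      then show False
        using le ultrafilter_not_iff[OF ultra_ultrafilter] unfolding le_filter_def by blast
    qed
    with le show ?thesis by (simp add: ultra_inject[symmetric])
  qed
  moreover have "n \<ge> 1" if "\<forall>\<^sub>F m in ultra \<omega>. m = n" for n
  proof -
    have "\<forall>\<^sub>F m in ultra \<omega>. m = n \<and> m \<ge> 1" using that ultra_ge_1 by (simp add: eventually_conj_iff)
    then show ?thesis using eventually_happens' ultra_neq_bot by blast
  qed
  ultimately show ?thesis
    unfolding Nstar_def by (auto simp: ultra_embN eventually_principal)
qed

lemma Nstar_nonempty: "Nstar \<noteq> {}"
proof -
  obtain F :: "nat filter" where F: "is_ultrafilter F" "F \<le> sequentially"
    using ex_ultrafilter_le[of sequentially] by auto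
  have *: "eventually P F" if "eventually P sequentially" for P
    using that F(2) by (rule filter_leD[rotated])
  then have u: "ultra (Abs_betaN F) = F"
    using F(1) eventually_ge_at_top by (intro Abs_betaN_inverse) blast
  have "\<not> (\<forall>\<^sub>F m in F. m = n)" for n
    using ultrafilter_not_iff[OF F(1), of "\<lambda>m. m = n"] *[of "\<lambda>m. m \<noteq> n"]
      eventually_mono[OF eventually_gt_at_top[of n], of "\<lambda>m. m \<noteq> n"] by auto
  then have "Abs_betaN F \<in> Nstar" by (simp add: Nstar_iff_free u)
  then show ?thesis by blast
qed


section \<open>The shift\<close>

text \<open>By \<open>continuous_tau\<close>, \<open>tau_embN\<close> and \<open>dense_embN\<close> this is the continuous extension of
  the successor map.\<close>

lift_definition tau :: "betaN \<Rightarrow> betaN" is "filtermap Suc"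
  by (auto simp: is_ultrafilter_filtermap eventually_filtermap)

lemma tau_embN: "n \<ge> 1 \<Longrightarrow> tau (embN n) = embN (n + 1)"
  by (simp add: ultra_inject[symmetric] tau.rep_eq ultra_embN)

lemma continuous_tau: "continuous_on UNIV tau"
  unfolding continuous_on_topological
proof (intro ballI allI impI)
  fix \<omega> B assume "open B" "tau \<omega> \<in> B"
  then obtain A where A: "\<forall>\<^sub>F n in ultra (tau \<omega>). n \<in> A" "{\<xi>. \<forall>\<^sub>F n in ultra \<xi>. n \<in> A} \<subseteq> B"
    unfolding open_betaN_def by blast
  then show "\<exists>U. open U \<and> \<omega> \<in> U \<and> (\<forall>y\<in>UNIV. y \<in> U \<longrightarrow> tau y \<in> B)"
    using open_betaN_basic[of "\<lambda>n. Suc n \<in> A"]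
    by (intro exI[of _ "{\<xi>. \<forall>\<^sub>F n in ultra \<xi>. Suc n \<in> A}"])
      (auto simp: tau.rep_eq eventually_filtermap)
qed

lemma inj_tau: "inj tau"
proof (rule injI)
  fix \<omega> \<xi> assume "tau \<omega> = tau \<xi>"
  then have "filtermap Suc (ultra \<omega>) = filtermap Suc (ultra \<xi>)" by (metis tau.rep_eq)
  then have "filtermap (\<lambda>n. n - 1) (filtermap Suc (ultra \<omega>)) = filtermap (\<lambda>n. n - 1) (filtermap Suc (ultra \<xi>))"
    by simp
  then show "\<omega> = \<xi>" by (simp add: filtermap_filtermap filtermap_ident ultra_inject)
qed

lemma tau_in_Nstar_iff: "tau \<omega> \<in> Nstar \<longleftrightarrow> \<omega> \<in> Nstar"
proof
  assume "tau \<omega> \<in> Nstar"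
  then show "\<omega> \<in> Nstar" unfolding Nstar_def using tau_embN by fastforce
next
  assume w: "\<omega> \<in> Nstar"
  have "\<not> (\<forall>\<^sub>F m in ultra \<omega>. Suc m = n)" for n
  proof
    assume "\<forall>\<^sub>F m in ultra \<omega>. Suc m = n"
    then have "\<forall>\<^sub>F m in ultra \<omega>. m = n - 1" by (rule eventually_mono) auto
    then show False using w Nstar_iff_free by blast
  qed
  then show "tau \<omega> \<in> Nstar" by (simp add: Nstar_iff_free tau.rep_eq eventually_filtermap)
qed

lemma bij_betw_tau: "bij_betw tau Nstar Nstar"
proof -
  have "\<exists>\<xi>. \<omega> = tau \<xi>" if w: "\<omega> \<in> Nstar" for \<omega>
  proof -
    have "\<forall>\<^sub>F n in ultra \<omega>. n \<noteq> 1"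
      using w ultrafilter_not_iff[OF ultra_ultrafilter] by (simp add: Nstar_iff_free)
    then have ev: "\<forall>\<^sub>F n in ultra \<omega>. n \<ge> 2"
      using ultra_ge_1[of \<omega>] by eventually_elim auto
    let ?F = "filtermap (\<lambda>n. n - 1) (ultra \<omega>)"
    have "is_ultrafilter ?F \<and> eventually (\<lambda>n. n \<ge> 1) ?F"
      using ev by (auto simp: is_ultrafilter_filtermap ultra_ultrafilter eventually_filtermap elim: eventually_mono)
    then have "ultra (Abs_betaN ?F) = ?F" by (simp add: Abs_betaN_inverse)
    moreover have "filtermap Suc ?F = ultra \<omega>"
    proof -
      have "filtermap (\<lambda>n. Suc (n - 1)) (ultra \<omega>) = filtermap (\<lambda>n. n) (ultra \<omega>)"
        unfolding filter_eq_iff eventually_filtermap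
        by (intro allI eventually_cong eventually_mono[OF ev]) auto
      then show ?thesis by (simp add: filtermap_filtermap filtermap_ident)
    qed
    ultimately have "\<omega> = tau (Abs_betaN ?F)" by (simp add: ultra_inject[symmetric] tau.rep_eq)
    then show ?thesis by blast
  qed
  then have "tau ` Nstar = Nstar" using tau_in_Nstar_iff by blast
  then show ?thesis using inj_tau by (auto simp: bij_betw_def intro: inj_on_subset)
qed

text \<open>Negative powers use the inverse of the bijection of \<^term>\<open>Nstar\<close> induced by
  \<^term>\<open>tau\<close>, so they are meaningful on \<^term>\<open>Nstar\<close> only.\<close>

definition tau_pow :: "int \<Rightarrow> betaN \<Rightarrow> betaN" where
  "tau_pow k = (if 0 \<le> k then tau ^^ nat k else inv_into Nstar tau ^^ nat (- k))"

lemma funpow_in: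
  assumes "\<And>x. x \<in> S \<Longrightarrow> f x \<in> S" "x \<in> S"
  shows "(f ^^ n) x \<in> S"
  using assms by (induction n) auto

lemma tau_pow_in_Nstar: "\<omega> \<in> Nstar \<Longrightarrow> tau_pow k \<omega> \<in> Nstar"
  unfolding tau_pow_def using bij_betw_tau
  by (auto intro!: funpow_in simp: tau_in_Nstar_iff bij_betw_def inv_into_into)

lemma tau_pow_tau: "\<omega> \<in> Nstar \<Longrightarrow> tau_pow k (tau \<omega>) = tau_pow (k + 1) \<omega>"
proof -
  assume w: "\<omega> \<in> Nstar"
  have inv: "inv_into Nstar tau (tau \<omega>) = \<omega>"
    using w bij_betw_tau by (simp add: bij_betw_def)
  consider "k \<ge> 0" | "k < 0" by linarith
  then show ?thesis
  proof cases
    case 1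
    then have "nat (k + 1) = Suc (nat k)" by simp
    then show ?thesis using 1 by (simp add: tau_pow_def funpow_swap1)
  next
    case 2
    define m where "m = nat (- k - 1)"
    have "nat (- k) = Suc m" "k + 1 = - int m" using 2 by (auto simp: m_def)
    then show ?thesis using 2 inv by (auto simp: tau_pow_def funpow_swap1)
  qed
qed


section \<open>The space \<open>\<Omega>\<^sup>*\<close> and its flow\<close>

definition cyl :: "(betaN \<times> real) set" where
  "cyl = Nstar \<times> {0..1}"

inductive glue :: "betaN \<times> real \<Rightarrow> betaN \<times> real \<Rightarrow> bool" where
  glueI: "\<omega> \<in> Nstar \<Longrightarrow> glue (\<omega>, 1) (tau \<omega>, 0)"

definition omega_rel :: "betaN \<times> real \<Rightarrow> betaN \<times> real \<Rightarrow> bool" where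
  "omega_rel p q \<longleftrightarrow> p \<in> cyl \<and> q \<in> cyl \<and> equivclp glue p q"

lemma part_equivp_omega_rel: "part_equivp omega_rel"
proof (rule part_equivpI)
  obtain \<omega> where "\<omega> \<in> Nstar" using Nstar_nonempty by blast
  then have "omega_rel (\<omega>, 0) (\<omega>, 0)" by (simp add: omega_rel_def cyl_def)
  then show "\<exists>x. omega_rel x x" by blast
  show "symp omega_rel" by (auto intro!: sympI simp: omega_rel_def intro: equivclp_sym)
  show "transp omega_rel" by (auto intro!: transpI simp: omega_rel_def intro: equivclp_trans)
qed

lemma omega_rel_invariant:
  assumes "omega_rel p q" and "\<And>\<omega>. \<omega> \<in> Nstar \<Longrightarrow> f (\<omega>, 1) = f (tau \<omega>, 0)"
  shows "f p = f q"
proof -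
  have "equivclp glue p q" using assms(1) by (simp add: omega_rel_def)
  then show ?thesis
    by (induction rule: equivclp_induct) (use assms(2) in \<open>auto elim!: glue.cases\<close>)
qed

quotient_type Omega = "betaN \<times> real" / partial: omega_rel
  by (rule part_equivp_omega_rel)

lemma omega_rel_refl: "omega_rel p p \<longleftrightarrow> p \<in> cyl"
  by (simp add: omega_rel_def)

lemma abs_Omega_glue: "\<omega> \<in> Nstar \<Longrightarrow> abs_Omega (\<omega>, 1) = abs_Omega (tau \<omega>, 0)"
  by (rule Quotient3_rel_abs[OF Quotient3_Omega])
    (simp add: omega_rel_def cyl_def tau_in_Nstar_iff r_into_equivclp glueI)

lemma abs_Omega_surj: "abs_Omega ` cyl = UNIV"
proof -
  have "rep_Omega \<eta> \<in> cyl \<and> abs_Omega (rep_Omega \<eta>) = \<eta>" for \<eta>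
    using Quotient3_rep_reflp[OF Quotient3_Omega, of \<eta>] Quotient3_abs_rep[OF Quotient3_Omega, of \<eta>]
    by (simp add: omega_rel_refl)
  then show ?thesis by (metis UNIV_eq_I image_eqI)
qed

text \<open>The quotient topology.\<close>

instantiation Omega :: topological_space
begin

definition open_Omega :: "Omega set \<Rightarrow> bool" where
  "open_Omega U \<longleftrightarrow> openin (top_of_set cyl) {p \<in> cyl. abs_Omega p \<in> U}"

instance
proof
  show "open (UNIV :: Omega set)" by (simp add: open_Omega_def)
next
  fix U V :: "Omega set"
  assume "open U" "open V"
  moreover have "{p \<in> cyl. abs_Omega p \<in> U \<inter> V} = {p \<in> cyl. abs_Omega p \<in> U} \<inter> {p \<in> cyl. abs_Omega p \<in> V}"
    by auto
  ultimately show "open (U \<inter> V)" unfolding open_Omega_def by (simp only: openin_Int)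
next
  fix K :: "Omega set set"
  assume "\<forall>U\<in>K. open U"
  moreover have "{p \<in> cyl. abs_Omega p \<in> \<Union>K} = \<Union>((\<lambda>U. {p \<in> cyl. abs_Omega p \<in> U}) ` K)"
    by auto
  ultimately show "open (\<Union>K)"
    unfolding open_Omega_def by (simp only:) (rule openin_Union, blast)
qed

end

lemma quotient_map_abs_Omega: "quotient_map (top_of_set cyl) euclidean abs_Omega"
  unfolding quotient_map_def
  by (simp add: abs_Omega_surj open_Omega_def)

lift_definition phi :: "real \<Rightarrow> Omega \<Rightarrow> Omega" is
  "\<lambda>s (\<omega>, t). (tau_pow \<lfloor>t + s\<rfloor> \<omega>, t + s - of_int \<lfloor>t + s\<rfloor>)"
proof -
  fix s p q assume r: "omega_rel p q"
  let ?f = "\<lambda>(\<omega>, t :: real). (tau_pow \<lfloor>t + s\<rfloor> \<omega>, t + s - of_int \<lfloor>t + s\<rfloor>)"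
  have "?f p = ?f q"
  proof (rule omega_rel_invariant[OF r, where f = ?f])
    fix \<omega> assume "\<omega> \<in> Nstar"
    then show "?f (\<omega>, 1) = ?f (tau \<omega>, 0)" by (simp add: tau_pow_tau add.commute)
  qed
  moreover have "?f p \<in> cyl"
  proof (cases p)
    case (Pair \<omega> t)
    have "0 \<le> t + s - of_int \<lfloor>t + s\<rfloor>" "t + s - of_int \<lfloor>t + s\<rfloor> \<le> 1" by linarith+
    then show ?thesis using r Pair by (simp add: omega_rel_def cyl_def tau_pow_in_Nstar)
  qed
  ultimately show "omega_rel (?f p) (?f q)" by (simp only: omega_rel_refl)
qed

lemma phi_abs_Omega:
  assumes "\<omega> \<in> Nstar" "0 \<le> t" "t \<le> 1"
  shows "phi s (abs_Omega (\<omega>, t)) = abs_Omega (tau_pow \<lfloor>t + s\<rfloor> \<omega>, t + s - of_int \<lfloor>t + s\<rfloor>)"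
  using phi.abs_eq[of "(\<omega>, t)" s] assms by (simp add: omega_rel_refl cyl_def)

definition backward_orbit :: "Omega \<Rightarrow> Omega set" where
  "backward_orbit \<eta> = {phi (- s) \<eta> | s. s \<ge> 0}"


section \<open>Finitely additive measures\<close>

text \<open>A measure on the power set of \<open>{1, 2, 3, \<dots>}\<close> is a function on \<^typ>\<open>nat set\<close> whose
  values are relevant at subsets of \<^term>\<open>{1..} :: nat set\<close> only.\<close>

definition fin_add_prob :: "(nat set \<Rightarrow> real) \<Rightarrow> bool" where
  "fin_add_prob \<mu> \<longleftrightarrow>
     \<mu> {1..} = 1 \<and> (\<forall>A\<subseteq>{1..}. 0 \<le> \<mu> A) \<and>
     (\<forall>A\<subseteq>{1..}. \<forall>B\<subseteq>{1..}. A \<inter> B = {} \<longrightarrow> \<mu> (A \<union> B) = \<mu> A + \<mu> B)"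

definition weakly_abs_cont :: "(nat set \<Rightarrow> real) \<Rightarrow> (nat set \<Rightarrow> real) \<Rightarrow> bool"  (infix "\<prec>" 50) where
  "\<nu> \<prec> \<mu> \<longleftrightarrow> (\<forall>A\<subseteq>{1..}. \<mu> A = 0 \<longrightarrow> \<nu> A = 0)"

definition density_upto :: "nat set \<Rightarrow> real \<Rightarrow> real" where
  "density_upto A x = real (card (A \<inter> {1..nat \<lfloor>x\<rfloor>})) / x"

lift_definition nu :: "Omega \<Rightarrow> nat set \<Rightarrow> real" is
  "\<lambda>(\<omega>, t) A. Lim (ultra \<omega>) (\<lambda>n. density_upto A (2 powr t * 2 ^ n))"
proof -
  fix p q assume r: "omega_rel p q"
  let ?f = "\<lambda>(\<omega>, t) A. Lim (ultra \<omega>) (\<lambda>n. density_upto A (2 powr t * 2 ^ n))"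
  show "?f p = ?f q"
  proof (rule omega_rel_invariant[OF r, where f = ?f])
    show "?f (\<omega>, 1) = ?f (tau \<omega>, 0)" for \<omega>
      by (simp add: tau.rep_eq t2_space_class.Lim_def filterlim_filtermap)
  qed
qed

lemma nu_abs_Omega:
  assumes "\<omega> \<in> Nstar" "0 \<le> t" "t \<le> 1"
  shows "nu (abs_Omega (\<omega>, t)) A = Lim (ultra \<omega>) (\<lambda>n. density_upto A (2 powr t * 2 ^ n))"
  using nu.abs_eq[of "(\<omega>, t)"] assms by (simp add: omega_rel_refl cyl_def)

lemma nu_tendsto:
  assumes "\<omega> \<in> Nstar" "0 \<le> t" "t \<le> 1"
  shows "((\<lambda>n. density_upto A (2 powr t * 2 ^ n)) \<longlongrightarrow> nu (abs_Omega (\<omega>, t)) A) (ultra \<omega>)"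
proof -
  have "density_upto A x \<in> {0..1}" if "x > 0" for x
  proof -
    have "card (A \<inter> {1..nat \<lfloor>x\<rfloor>}) \<le> card {1..nat \<lfloor>x\<rfloor>}" by (rule card_mono) auto
    then have "real (card (A \<inter> {1..nat \<lfloor>x\<rfloor>})) \<le> real (nat \<lfloor>x\<rfloor>)" by simp
    also have "\<dots> \<le> x" using that by linarith
    finally show ?thesis using that by (simp add: density_upto_def)
  qed
  then obtain l where "((\<lambda>n. density_upto A (2 powr t * 2 ^ n)) \<longlongrightarrow> l) (ultra \<omega>)"
    using ultrafilter_tendsto_compact[OF ultra_ultrafilter compact_Icc[of "0::real" 1],
        of "\<lambda>n. density_upto A (2 powr t * 2 ^ n)" \<omega>] by fastforce
  then show ?thesis using tendsto_Lim[OF ultra_neq_bot] nu_abs_Omega[OF assms] by metis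
qed

lemma Nstar_le_sequentially:
  assumes "\<omega> \<in> Nstar"
  shows "ultra \<omega> \<le> sequentially"
proof -
  have "\<forall>\<^sub>F n in ultra \<omega>. n \<ge> N" for N
  proof (induction N)
    case (Suc N)
    have "\<forall>\<^sub>F n in ultra \<omega>. n \<noteq> N"
      using assms ultrafilter_not_iff[OF ultra_ultrafilter] by (simp add: Nstar_iff_free)
    with Suc show ?case by eventually_elim auto
  qed simp
  then have "eventually P (ultra \<omega>)" if "\<forall>n\<ge>N. P n" for P N
    by (rule eventually_mono) (use that in blast)
  then show ?thesis unfolding le_filter_def eventually_sequentially by blast
qed

lemma fin_add_prob_nu: "fin_add_prob (nu \<eta>)"
proof -
  have "\<eta> \<in> abs_Omega ` cyl" by (simp only: abs_Omega_surj UNIV_I)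
  then obtain \<omega> t where p: "\<omega> \<in> Nstar" "0 \<le> t" "t \<le> 1" and \<eta>: "\<eta> = abs_Omega (\<omega>, t)"
    by (auto simp: cyl_def)
  let ?x = "\<lambda>n::nat. 2 powr t * 2 ^ n :: real"
  note lim = nu_tendsto[OF p, folded \<eta>]
  have pos: "?x n > 0" for n by simp
  have x: "filterlim ?x at_top sequentially"
  proof (rule filterlim_tendsto_pos_mult_at_top[OF tendsto_const])
    have "filterlim (\<lambda>n. inverse ((1 / 2 :: real) ^ n)) at_top sequentially"
      by (rule filterlim_inverse_at_top[OF LIMSEQ_power_zero]) simp_all
    then show "filterlim (\<lambda>n. 2 ^ n :: real) at_top sequentially"
      by (simp add: power_one_over inverse_eq_divide)
  qed simp
  have "(\<lambda>n. density_upto {1..} (?x n)) \<longlonglongrightarrow> 1"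
  proof (rule tendsto_sandwich)
    have d: "density_upto {1..} (?x n) = real (nat \<lfloor>?x n\<rfloor>) / ?x n" for n
      by (simp add: density_upto_def Int_absorb1)
    show "\<forall>\<^sub>F n in sequentially. 1 - 1 / ?x n \<le> density_upto {1..} (?x n)"
    proof (rule always_eventually, rule allI)
      fix n
      have "?x n - 1 \<le> real (nat \<lfloor>?x n\<rfloor>)" by linarith
      then have "(?x n - 1) / ?x n \<le> real (nat \<lfloor>?x n\<rfloor>) / ?x n"
        using pos[of n] by (intro divide_right_mono) auto
      then show "1 - 1 / ?x n \<le> density_upto {1..} (?x n)"
        unfolding d using pos[of n] by (simp add: diff_divide_distrib)
    qed
    show "\<forall>\<^sub>F n in sequentially. density_upto {1..} (?x n) \<le> 1"
    proof (rule always_eventually, rule allI)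
      fix n
      have "real (nat \<lfloor>?x n\<rfloor>) \<le> ?x n" using pos[of n] by linarith
      then show "density_upto {1..} (?x n) \<le> 1" unfolding d using pos[of n] by simp
    qed
    have "(\<lambda>n. 1 / ?x n) \<longlonglongrightarrow> 0" by (rule tendsto_divide_0[OF tendsto_const filterlim_at_top_imp_at_infinity[OF x]])
    then show "(\<lambda>n. 1 - 1 / ?x n) \<longlonglongrightarrow> 1" using tendsto_diff[OF tendsto_const[of "1::real"]] by fastforce
  qed simp
  then have "((\<lambda>n. density_upto {1..} (?x n)) \<longlongrightarrow> 1) (ultra \<omega>)"
    using Nstar_le_sequentially[OF p(1)] by (rule tendsto_mono[rotated])
  then have "nu \<eta> {1..} = 1" using tendsto_unique[OF ultra_neq_bot lim] by blast
  moreover have "0 \<le> nu \<eta> A" for A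
    by (rule tendsto_lowerbound[OF lim _ ultra_neq_bot]) (simp add: density_upto_def)
  moreover have "nu \<eta> (A \<union> B) = nu \<eta> A + nu \<eta> B" if "A \<inter> B = {}" for A B
  proof -
    have "density_upto (A \<union> B) y = density_upto A y + density_upto B y" for y
    proof -
      have "card ((A \<union> B) \<inter> {1..nat \<lfloor>y\<rfloor>}) = card (A \<inter> {1..nat \<lfloor>y\<rfloor>}) + card (B \<inter> {1..nat \<lfloor>y\<rfloor>})"
        unfolding Int_Un_distrib2 using that by (intro card_Un_disjoint) auto
      then show ?thesis by (simp add: density_upto_def add_divide_distrib)
    qed
    then show ?thesis
      using tendsto_unique[OF ultra_neq_bot lim[of "A \<union> B"]] tendsto_add[OF lim[of A] lim[of B]] by simp
  qed
  ultimately show ?thesis by (simp add: fin_add_prob_def)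
qed

end

theory Submission
  imports Defs
begin

text \<open>
  Along the backward flow the density of a set \<open>A\<close> grows at most by the factor \<open>2\<^sup>s\<close>, so the
  condition \<open>\<nu>\<^sub>\<zeta>(A) = 0\<close> passes from \<open>\<eta>\<close> to its backward orbit; as it is a closed
  condition on \<open>\<zeta>\<close>, it passes to the closure. Conversely, if \<open>\<eta>' = (\<omega>', t')\<close> with \<open>0 < t'\<close> has a
  neighbourhood, given by \<open>B \<in> \<omega>'\<close> and \<open>\<epsilon> > 0\<close>, that misses the backward orbit of \<open>\<eta>\<close>, then
  the union of the blocks \<open>(2\<^bsup>n + t' - \<epsilon>\<^esup>, 2\<^bsup>n + t'\<^esup>]\<close> over \<open>n \<in> B\<close> has positive \<open>\<nu>\<^bsub>\<eta>'\<^esub>\<close>-measure.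
  It is \<open>\<nu>\<^sub>\<eta>\<close>-null: a block meeting \<open>(2\<^bsup>n + t - M\<^esup>, 2\<^bsup>n + t\<^esup>]\<close> for \<open>\<omega>\<close>-many \<open>n\<close> would produce a
  point of the backward orbit inside the neighbourhood.
\<close>

section \<open>Representatives of points and negative powers of the shift\<close>

text \<open>With \<open>t < 1\<close>, flowing back by \<open>s \<ge> 0\<close> gives
  \<open>\<lfloor>t - s\<rfloor> \<le> 0\<close>, so no positive power of \<open>tau\<close>
  occurs.\<close>

lemma Omega_cases_less_1:
  obtains \<omega> t where "\<omega> \<in> Nstar" "0 \<le> t" "t < 1" "\<eta> = abs_Omega (\<omega>, t)"
proof -
  have "\<eta> \<in> abs_Omega ` cyl" by (simp only: abs_Omega_surj UNIV_I)
  then obtain \<omega> t where p: "\<omega> \<in> Nstar" "0 \<le> t" "t \<le> 1" "\<eta> = abs_Omega (\<omega>, t)"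
    by (auto simp: cyl_def)
  show ?thesis
  proof (cases "t = 1")
    case True
    then show ?thesis using p that[of "tau \<omega>" 0] by (simp add: abs_Omega_glue tau_in_Nstar_iff)
  qed (use p that[of \<omega> t] in auto)
qed

text \<open>A representative with \<open>t > 0\<close> leaves room below \<open>t\<close> inside one
  fibre, so a one-sided neighbourhood need not cross the gluing.\<close>

lemma Omega_cases_greater_0:
  obtains \<omega> t where "\<omega> \<in> Nstar" "0 < t" "t \<le> 1" "\<eta> = abs_Omega (\<omega>, t)"
proof -
  obtain \<omega> t where p: "\<omega> \<in> Nstar" "0 \<le> t" "t < 1" "\<eta> = abs_Omega (\<omega>, t)"
    by (rule Omega_cases_less_1)
  show ?thesis
  proof (cases "t = 0")
    case True
    obtain \<xi> where "\<xi> \<in> Nstar" "\<omega> = tau \<xi>"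
      using p(1) bij_betw_tau by (auto simp: bij_betw_def)
    then show ?thesis using p True that[of \<xi> 1] by (simp add: abs_Omega_glue)
  qed (use p that[of \<omega> t] in auto)
qed

text \<open>Turns a limit along \<open>\<omega>\<close> into a limit, along its \<open>j\<close>-th
  preimage under \<open>tau\<close>, of the sequence shifted by \<open>j\<close>.\<close>

lemma ultra_tau_pow_neg:
  assumes "\<omega> \<in> Nstar"
  shows "ultra \<omega> = filtermap (\<lambda>n. n + j) (ultra (tau_pow (- int j) \<omega>))"
proof -
  have pow: "tau_pow (- int j) = inv_into Nstar tau ^^ j" for j
    by (cases "j = 0") (simp_all add: tau_pow_def)
  show ?thesis
  proof (induction j)
    case 0
    then show ?case by (simp add: tau_pow_def filtermap_ident)
  next
    case (Suc j)
    let ?\<xi> = "tau_pow (- int j) \<omega>" and ?\<zeta> = "tau_pow (- int (Suc j)) \<omega>"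
    have "?\<xi> \<in> tau ` Nstar"
      using tau_pow_in_Nstar[OF assms] bij_betw_tau by (auto simp: bij_betw_def)
    then have "?\<xi> = tau ?\<zeta>" unfolding pow by (simp add: f_inv_into_f)
    then have "ultra ?\<xi> = filtermap Suc (ultra ?\<zeta>)" by (simp only: tau.rep_eq)
    with Suc show ?case by (simp only: filtermap_filtermap) simp
  qed
qed

section \<open>Densities under a change of the cut-off\<close>

lemma density_upto_nonneg: "0 \<le> x \<Longrightarrow> 0 \<le> density_upto A x"
  by (simp add: density_upto_def)

lemma density_upto_mult:
  "0 < x \<Longrightarrow> density_upto A x * x = real (card (A \<inter> {1..nat \<lfloor>x\<rfloor>}))"
  by (simp add: density_upto_def)

text \<open>The count is monotone in the cut-off, so only the change of denominator costs a
  factor.\<close>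

lemma density_upto_scale:
  assumes "0 < x" "x \<le> y"
  shows "density_upto A x \<le> y / x * density_upto A y"
proof -
  have "card (A \<inter> {1..nat \<lfloor>x\<rfloor>}) \<le> card (A \<inter> {1..nat \<lfloor>y\<rfloor>})"
    using nat_mono[OF floor_mono[OF assms(2)]] by (intro card_mono) auto
  then show ?thesis using assms by (simp add: density_upto_def divide_right_mono)
qed

text \<open>The summand 1 absorbs the rounding of both cut-offs. It is negligible for large
  cut-offs, so densities are stable under small changes of \<open>t\<close>.\<close>

lemma density_upto_mult_le:
  assumes "0 < x" "0 < y"
  shows "density_upto A y * y \<le> density_upto A x * x + \<bar>y - x\<bar> + 1"
proof -
  have "A \<inter> {1..nat \<lfloor>y\<rfloor>} \<subseteq> (A \<inter> {1..nat \<lfloor>x\<rfloor>}) \<union> {nat \<lfloor>x\<rfloor><..nat \<lfloor>y\<rfloor>}" by auto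
  then have "card (A \<inter> {1..nat \<lfloor>y\<rfloor>}) \<le> card ((A \<inter> {1..nat \<lfloor>x\<rfloor>}) \<union> {nat \<lfloor>x\<rfloor><..nat \<lfloor>y\<rfloor>})"
    by (intro card_mono) auto
  also have "\<dots> \<le> card (A \<inter> {1..nat \<lfloor>x\<rfloor>}) + card {nat \<lfloor>x\<rfloor><..nat \<lfloor>y\<rfloor>}"
    by (rule card_Un_le)
  finally have "real (card (A \<inter> {1..nat \<lfloor>y\<rfloor>})) \<le>
      real (card (A \<inter> {1..nat \<lfloor>x\<rfloor>})) + real (nat \<lfloor>y\<rfloor> - nat \<lfloor>x\<rfloor>)"
    by simp
  moreover have "real (nat \<lfloor>y\<rfloor> - nat \<lfloor>x\<rfloor>) \<le> \<bar>y - x\<bar> + 1"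
    using assms by linarith
  ultimately show ?thesis using assms by (simp add: density_upto_mult)
qed

section \<open>Null sets along the backward orbit\<close>

lemma nu_nonneg: "A \<subseteq> {1..} \<Longrightarrow> 0 \<le> nu \<eta> A"
  using fin_add_prob_nu by (auto simp: fin_add_prob_def)

lemma nu_phi_eq_0:
  assumes A: "A \<subseteq> {1..}" and null: "nu \<eta> A = 0" and s: "0 \<le> s"
  shows "nu (phi (- s) \<eta>) A = 0"
proof -
  obtain \<omega> t where p: "\<omega> \<in> Nstar" "0 \<le> t" "t < 1" and \<eta>: "\<eta> = abs_Omega (\<omega>, t)"
    by (rule Omega_cases_less_1)
  define j where "j = nat (- \<lfloor>t - s\<rfloor>)"
  have "\<lfloor>t - s\<rfloor> \<le> 0" using p s by linarith
  then have j: "\<lfloor>t - s\<rfloor> = - int j" by (simp add: j_def)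
  \<comment> \<open>\<open>f\<close> is the fractional part of \<open>t - s\<close>, hence the
    second coordinate after the flow.\<close>
  define f where "f = t - s + real j"
  have f: "0 \<le> f" "f \<le> 1" using j unfolding f_def by linarith+
  let ?\<xi> = "tau_pow (- int j) \<omega>"
  have \<xi>: "?\<xi> \<in> Nstar" using p by (simp add: tau_pow_in_Nstar)
  have phi: "phi (- s) \<eta> = abs_Omega (?\<xi>, f)"
    using p j by (simp add: \<eta> phi_abs_Omega f_def)
  have "((\<lambda>n. density_upto A (2 powr t * 2 ^ n)) \<longlongrightarrow> 0) (ultra \<omega>)"
    using nu_tendsto[of \<omega> t A] p null \<eta> by simp
  then have "((\<lambda>n. density_upto A (2 powr t * 2 ^ (n + j))) \<longlongrightarrow> 0) (ultra ?\<xi>)"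
    by (subst (asm) ultra_tau_pow_neg[OF p(1), of j]) (simp add: filterlim_filtermap)
  then have lim: "((\<lambda>n. 2 powr s * density_upto A (2 powr t * 2 ^ (n + j))) \<longlongrightarrow> 0) (ultra ?\<xi>)"
    using tendsto_mult_right_zero by blast
  have le: "density_upto A (2 powr f * 2 ^ n) \<le> 2 powr s * density_upto A (2 powr t * 2 ^ (n + j))" for n
  proof -
    have eq: "2 powr t * 2 ^ (n + j) = 2 powr s * (2 powr f * 2 ^ n)"
      unfolding f_def by (simp add: powr_add powr_diff powr_realpow power_add)
    have "1 * (2 powr f * 2 ^ n) \<le> 2 powr s * (2 powr f * 2 ^ n)"
      using s by (intro mult_right_mono) (simp_all add: ge_one_powr_ge_zero)
    then show ?thesis
      using density_upto_scale[of "2 powr f * 2 ^ n" "2 powr t * 2 ^ (n + j)" A] unfolding eq by simp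
  qed
  have "((\<lambda>n. density_upto A (2 powr f * 2 ^ n)) \<longlongrightarrow> 0) (ultra ?\<xi>)"
    by (rule tendsto_sandwich[OF _ _ tendsto_const lim])
      (use le in \<open>auto intro!: always_eventually density_upto_nonneg\<close>)
  then show ?thesis
    using tendsto_unique[OF ultra_neq_bot nu_tendsto[OF \<xi> f, of A]] phi by simp
qed

section \<open>Being null is a closed condition\<close>

lemma filterlim_scaled_power_at_top:
  assumes "\<omega> \<in> Nstar"
  shows "filterlim (\<lambda>n. 2 powr t * 2 ^ n :: real) at_top (ultra \<omega>)"
proof -
  have "filterlim (\<lambda>n. 2 ^ n :: real) at_top (ultra \<omega>)"
    by (rule filterlim_at_infinity_imp_filterlim_at_top
        [OF filterlim_mono[OF filterlim_realpow_sequentially_gt1 order_refl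
          Nstar_le_sequentially[OF assms]]]) simp_all
  then show ?thesis
    by (rule filterlim_tendsto_pos_mult_at_top[OF tendsto_const, rotated]) simp
qed

text \<open>A density bound at \<open>t'\<close> holds on a set of indices \<open>n\<close>, and
  every ultrafilter containing that set inherits it; nearby \<open>t\<close> change it little.
  Openness is tested in \<open>cyl\<close>, so each representative of a glued point is treated
  separately.\<close>

lemma open_nu_pos: "open {\<eta>. 0 < nu \<eta> A}"
  unfolding open_Omega_def
proof (subst openin_subopen, clarify)
  fix \<omega>' t' assume "(\<omega>', t') \<in> cyl" and pos: "0 < nu (abs_Omega (\<omega>', t')) A"
  then have p': "\<omega>' \<in> Nstar" "0 \<le> t'" "t' \<le> 1" by (auto simp: cyl_def)
  define c where "c = nu (abs_Omega (\<omega>', t')) A"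
  have c: "c > 0" using pos by (simp add: c_def)
  define B where "B = (\<lambda>n. density_upto A (2 powr t' * 2 ^ n) > c / 2)"
  have B: "eventually B (ultra \<omega>')"
    using order_tendstoD(1)[OF nu_tendsto[OF p', of A], of "c / 2"] c
    by (simp add: B_def c_def)
  \<comment> \<open>Moving the cut-off and rounding will each cost at most \<open>c / 8\<close> of
    the cut-off at \<open>t'\<close>, which leaves \<open>c / 4\<close> out of
    \<open>c / 2\<close>.\<close>
  define J where "J = {t :: real. \<bar>2 powr t - 2 powr t'\<bar> < c / 8 * 2 powr t'}"
  have "open J"
    unfolding J_def by (intro open_Collect_less continuous_intros) auto
  define W where "W = {\<xi>. eventually B (ultra \<xi>)}"
  have "openin (top_of_set cyl) (cyl \<inter> W \<times> J)"
    using \<open>open J\<close> open_betaN_basic[of B]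
    by (auto simp: W_def intro!: openin_open_Int open_Times)
  moreover have "(\<omega>', t') \<in> cyl \<inter> W \<times> J"
    using B c \<open>(\<omega>', t') \<in> cyl\<close> by (simp add: W_def J_def)
  moreover have "0 < nu (abs_Omega (\<xi>, t)) A" if "(\<xi>, t) \<in> cyl" "\<xi> \<in> W" "t \<in> J" for \<xi> t
  proof -
    have p: "\<xi> \<in> Nstar" "0 \<le> t" "t \<le> 1" using that by (auto simp: cyl_def)
    have "\<forall>\<^sub>F n in ultra \<xi>. 2 powr t' * 2 ^ n \<ge> 8 / c"
      using filterlim_scaled_power_at_top[OF p(1)] by (simp add: filterlim_at_top)
    moreover have "eventually B (ultra \<xi>)" using that by (simp add: W_def)
    ultimately have "\<forall>\<^sub>F n in ultra \<xi>. c / 8 \<le> density_upto A (2 powr t * 2 ^ n)"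
    proof eventually_elim
      case (elim n)
      let ?x = "2 powr t * 2 ^ n :: real" and ?y = "2 powr t' * 2 ^ n :: real"
      have "\<bar>?y - ?x\<bar> = \<bar>2 powr t - 2 powr t'\<bar> * 2 ^ n"
        by (simp add: abs_mult abs_minus_commute flip: left_diff_distrib)
      also have "\<dots> \<le> c / 8 * 2 powr t' * 2 ^ n"
        using that by (intro mult_right_mono) (auto simp: J_def)
      finally have 1: "\<bar>?y - ?x\<bar> \<le> c / 8 * ?y" by (simp add: mult.assoc)
      have 2: "1 \<le> c / 8 * ?y" using elim c by (simp add: field_simps)
      have 3: "density_upto A ?y * ?y \<ge> c / 2 * ?y"
        using elim by (intro mult_right_mono) (auto simp: B_def)
      have 4: "density_upto A ?y * ?y \<le> density_upto A ?x * ?x + \<bar>?y - ?x\<bar> + 1"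
        by (rule density_upto_mult_le) auto
      \<comment> \<open>Since \<open>t\<close> and \<open>t'\<close> lie in the unit interval,
        \<open>?x \<le> 2 * ?y\<close>; this turns \<open>c / 4 * ?y\<close> into
        \<open>c / 8 * ?x\<close>.\<close>
      have "2 powr t \<le> (2 :: real) powr (1 + t')" using p p' by (intro powr_mono) auto
      then have "?x \<le> 2 * ?y" by (simp add: powr_add)
      then have "c / 8 * ?x \<le> c / 4 * ?y"
        using c mult_left_mono[of ?x "2 * ?y" "c / 8"] by simp
      then have "c / 8 * ?x \<le> density_upto A ?x * ?x"
        using 1 2 3 4 by linarith
      then show ?case by (rule mult_right_le_imp_le) simp
    qed
    then have "c / 8 \<le> nu (abs_Omega (\<xi>, t)) A"
      by (rule tendsto_lowerbound[OF nu_tendsto[OF p] _ ultra_neq_bot])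
    then show ?thesis using c by linarith
  qed
  ultimately show "\<exists>T. openin (top_of_set cyl) T \<and> (\<omega>', t') \<in> T \<and>
      T \<subseteq> {p \<in> cyl. abs_Omega p \<in> {\<eta>. 0 < nu \<eta> A}}"
    by (intro exI[of _ "cyl \<inter> W \<times> J"]) auto
qed

lemma weakly_abs_cont_if_closure:
  assumes "\<eta>' \<in> closure (backward_orbit \<eta>)"
  shows "nu \<eta>' \<prec> nu \<eta>"
  unfolding weakly_abs_cont_def
proof (intro allI impI)
  fix A :: "nat set" assume A: "A \<subseteq> {1..}" and null: "nu \<eta> A = 0"
  have "{\<zeta>. nu \<zeta> A = 0} = - {\<zeta>. 0 < nu \<zeta> A}"
    using nu_nonneg[OF A] by (auto simp: less_le)
  then have "closed {\<zeta>. nu \<zeta> A = 0}" using open_nu_pos[of A] by (simp add: closed_def)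
  moreover have "backward_orbit \<eta> \<subseteq> {\<zeta>. nu \<zeta> A = 0}"
    using nu_phi_eq_0[OF A null] by (auto simp: backward_orbit_def)
  ultimately show "nu \<eta>' A = 0" using assms closure_minimal by blast
qed

section \<open>A separating set for a point outside the orbit closure\<close>

lemma closure_if_weakly_abs_cont:
  assumes ac: "nu \<eta>' \<prec> nu \<eta>"
  shows "\<eta>' \<in> closure (backward_orbit \<eta>)"
proof (rule ccontr)
  define U where "U = - closure (backward_orbit \<eta>)"
  assume "\<eta>' \<notin> closure (backward_orbit \<eta>)"
  then have U: "open U" "\<eta>' \<in> U" by (simp_all add: U_def open_Compl)
  have orbit: "phi (- s) \<eta> \<notin> U" if "0 \<le> s" for s
    using that closure_subset[of "backward_orbit \<eta>"] by (auto simp: U_def backward_orbit_def)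
  obtain \<omega> t where p: "\<omega> \<in> Nstar" "0 \<le> t" "t < 1" and \<eta>: "\<eta> = abs_Omega (\<omega>, t)"
    by (rule Omega_cases_less_1)
  obtain \<omega>' t' where p': "\<omega>' \<in> Nstar" "0 < t'" "t' \<le> 1" and \<eta>': "\<eta>' = abs_Omega (\<omega>', t')"
    by (rule Omega_cases_greater_0)
  obtain V where V: "open V" "{p \<in> cyl. abs_Omega p \<in> U} = cyl \<inter> V"
    using U(1) unfolding open_Omega_def openin_open by blast
  have "(\<omega>', t') \<in> V" using V(2) p' U(2) \<eta>' by (auto simp: cyl_def)
  then obtain W J where W: "open W" "\<omega>' \<in> W" and J: "open J" "t' \<in> J" and WJ: "W \<times> J \<subseteq> V"
    using V(1) by (auto elim!: open_prod_elim)
  obtain B where B: "\<forall>\<^sub>F n in ultra \<omega>'. n \<in> B" "{\<xi>. \<forall>\<^sub>F n in ultra \<xi>. n \<in> B} \<subseteq> W"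
    using W unfolding open_betaN_def by blast
  obtain \<epsilon>' where \<epsilon>': "\<epsilon>' > 0" "ball t' \<epsilon>' \<subseteq> J" using J openE by blast
  \<comment> \<open>The bound \<open>\<epsilon> \<le> t'\<close> keeps the strip below
    \<open>t'\<close> inside \<open>cyl\<close>.\<close>
  define \<epsilon> where "\<epsilon> = min \<epsilon>' t'"
  have \<epsilon>: "0 < \<epsilon>" "\<epsilon> \<le> t'" using \<epsilon>' p' by (auto simp: \<epsilon>_def)
  have nbhd: "abs_Omega (\<xi>, r) \<in> U"
    if "\<xi> \<in> Nstar" "\<forall>\<^sub>F n in ultra \<xi>. n \<in> B" "t' - \<epsilon> < r" "r \<le> t'" for \<xi> r
  proof -
    have "r \<in> ball t' \<epsilon>'" using that by (auto simp: \<epsilon>_def dist_real_def)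
    then have "(\<xi>, r) \<in> W \<times> J" using that(2) B(2) \<epsilon>'(2) by blast
    then have "(\<xi>, r) \<in> cyl \<inter> V" using that \<epsilon> WJ p' by (auto simp: cyl_def)
    then show ?thesis using V(2) by blast
  qed
  have avoid: "\<forall>\<^sub>F n in ultra \<omega>. \<not> (\<exists>k\<in>B. n = k + j)" if j: "t' - \<epsilon> - t < real j" for j
  proof -
    let ?\<xi> = "tau_pow (- int j) \<omega>"
    \<comment> \<open>The lower bound on \<open>\<delta>\<close> makes the time \<open>s\<close>
      nonnegative; \<open>\<delta> < \<epsilon>\<close> puts the endpoint
      \<open>t' - \<delta>\<close> into the strip. The two together place
      \<open>t' - \<delta>\<close> strictly between 0 and 1, which fixes the floor.\<close>
    obtain \<delta> where \<delta>: "max 0 (t' - t - real j) < \<delta>" "\<delta> < \<epsilon>"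
      using dense[of "max 0 (t' - t - real j)" \<epsilon>] j \<epsilon> by auto
    define s where "s = t + real j - t' + \<delta>"
    have s: "0 \<le> s" using \<delta> by (simp add: s_def)
    have fl: "\<lfloor>t - s\<rfloor> = - int j"
      by (rule floor_unique) (use \<delta> \<epsilon> p' in \<open>auto simp: s_def\<close>)
    have "phi (- s) \<eta> = abs_Omega (?\<xi>, t' - \<delta>)"
      using p fl by (simp add: \<eta> phi_abs_Omega) (simp add: s_def)
    then have "\<not> (\<forall>\<^sub>F n in ultra ?\<xi>. n \<in> B)"
      using orbit[OF s] nbhd[of ?\<xi> "t' - \<delta>"] \<delta> tau_pow_in_Nstar[OF p(1)] by auto
    then have "\<forall>\<^sub>F n in ultra ?\<xi>. n \<notin> B" using ultrafilter_not_iff[OF ultra_ultrafilter] by blast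
    then show ?thesis
      by (subst ultra_tau_pow_neg[OF p(1), of j])
        (auto simp: eventually_filtermap elim!: eventually_mono)
  qed
  define A where "A = (\<Union>k\<in>B. {m. 1 \<le> m \<and> 2 powr (k + t' - \<epsilon>) < real m \<and> real m \<le> 2 powr (k + t')})"
  have A: "A \<subseteq> {1..}" by (auto simp: A_def)
  have "nu \<eta> A \<le> (1 / 2) ^ M" for M
  proof -
    \<comment> \<open>Only finitely many \<open>j\<close> can be excluded at once, which is why
      \<open>M\<close> is fixed first and sent to infinity at the end.\<close>
    have "\<forall>\<^sub>F n in ultra \<omega>. \<forall>j\<in>{..M}. t' - \<epsilon> - t < real j \<longrightarrow> \<not> (\<exists>k\<in>B. n = k + j)"
    proof (rule eventually_ball_finite)
      show "\<forall>j\<in>{..M}. \<forall>\<^sub>F n in ultra \<omega>. t' - \<epsilon> - t < real j \<longrightarrow> \<not> (\<exists>k\<in>B. n = k + j)"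
        using avoid by (auto intro: eventually_mono)
    qed simp
    then have "\<forall>\<^sub>F n in ultra \<omega>. density_upto A (2 powr t * 2 ^ n) \<le> (1 / 2) ^ M"
    proof eventually_elim
      case (elim n)
      let ?x = "2 powr t * 2 ^ n :: real"
      have x: "?x = 2 powr (t + n)" by (simp add: powr_add powr_realpow)
      \<comment> \<open>A larger \<open>m\<close> would lie in a block with index \<open>k\<close>,
        and \<open>j = n - k\<close> would be one of the excluded shifts.\<close>
      have "real m \<le> ?x / 2 ^ M" if m: "m \<in> A" "real m \<le> ?x" for m
      proof (rule ccontr)
        assume "\<not> real m \<le> ?x / 2 ^ M"
        then have low: "2 powr (t + n - M) < real m"
          by (simp add: x powr_diff powr_realpow)
        obtain k where k: "k \<in> B" "2 powr (k + t' - \<epsilon>) < real m" "real m \<le> 2 powr (k + t')"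
          using m(1) by (auto simp: A_def)
        have "2 powr (k + t' - \<epsilon>) < (2 :: real) powr (t + n)" using k m(2) x by linarith
        then have 1: "k + t' - \<epsilon> < t + n" by simp
        have "2 powr (t + n - M) < (2 :: real) powr (k + t')" using k low by linarith
        then have 2: "t + n - M < k + t'" by simp
        \<comment> \<open>The bounds \<open>t < 1\<close> and \<open>\<epsilon> \<le> t'\<close>
          exclude \<open>k = n + 1\<close>; likewise \<open>t' \<le> 1\<close> and
          \<open>0 \<le> t\<close> exclude \<open>n - k = M + 1\<close> below.\<close>
        have "real k < real n + 1" using 1 p \<epsilon> by linarith
        then have kn: "k \<le> n" by linarith
        have "real n < real k + real M + 1" using 2 p p' by linarith
        then have "n - k \<le> M" by linarith
        moreover have "t' - \<epsilon> - t < real (n - k)" using 1 kn by (simp add: of_nat_diff)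
        ultimately show False using elim k(1) kn by force
      qed
      then have "A \<inter> {1..nat \<lfloor>?x\<rfloor>} \<subseteq> {1..nat \<lfloor>?x / 2 ^ M\<rfloor>}"
        by (auto simp: le_nat_floor le_nat_iff le_floor_iff)
      then have "card (A \<inter> {1..nat \<lfloor>?x\<rfloor>}) \<le> card {1..nat \<lfloor>?x / 2 ^ M\<rfloor>}"
        by (intro card_mono) auto
      also have "real \<dots> \<le> ?x / 2 ^ M" by simp
      finally have "density_upto A ?x \<le> (?x / 2 ^ M) / ?x"
        unfolding density_upto_def by (intro divide_right_mono) auto
      then show ?case by (simp add: power_one_over)
    qed
    then show ?thesis
      using tendsto_upperbound[OF nu_tendsto[of \<omega> t A] _ ultra_neq_bot] p \<eta> by simp
  qed
  then have "nu \<eta> A \<le> 0"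
    by (intro LIMSEQ_le_const[OF LIMSEQ_power_zero[of "1 / 2 :: real"]]) auto
  then have "nu \<eta> A = 0" using nu_nonneg[OF A, of \<eta>] by linarith
  then have null: "nu \<eta>' A = 0" using ac A by (simp add: weakly_abs_cont_def)
  \<comment> \<open>\<open>c\<close> is the length of a block relative to its right end.\<close>
  define c where "c = 1 - 2 powr (- \<epsilon>)"
  have c: "c > 0" using \<epsilon> by (simp add: c_def powr_less_one)
  \<comment> \<open>From here on, the integer lost by rounding is at most half of the block
    length.\<close>
  have "\<forall>\<^sub>F n in ultra \<omega>'. 2 powr t' * 2 ^ n \<ge> 2 / c"
    using filterlim_scaled_power_at_top[OF p'(1)] by (simp add: filterlim_at_top)
  with B(1) have "\<forall>\<^sub>F n in ultra \<omega>'. c / 2 \<le> density_upto A (2 powr t' * 2 ^ n)"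
  proof eventually_elim
    case (elim n)
    let ?y = "2 powr t' * 2 ^ n :: real"
    have y: "?y = 2 powr (n + t')" by (simp add: powr_add powr_realpow)
    have z: "?y * (1 - c) = 2 powr (n + t' - \<epsilon>)"
      by (simp add: c_def powr_add powr_diff powr_minus powr_realpow divide_inverse)
    \<comment> \<open>For \<open>n \<in> B\<close> the block with \<open>k = n\<close> ends exactly
      at the cut-off \<open>?y\<close>, so it is counted in full.\<close>
    have "{nat \<lfloor>?y * (1 - c)\<rfloor><..nat \<lfloor>?y\<rfloor>} \<subseteq> A \<inter> {1..nat \<lfloor>?y\<rfloor>}"
    proof
      fix m assume m: "m \<in> {nat \<lfloor>?y * (1 - c)\<rfloor><..nat \<lfloor>?y\<rfloor>}"
      have "?y * (1 - c) < real m" using m by (simp add: nat_less_iff floor_less_iff) linarith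
      then have "2 powr (n + t' - \<epsilon>) < real m" by (simp only: z)
      moreover have "0 \<le> ?y" by simp
      then have "real m \<le> ?y" using m by simp linarith
      then have "real m \<le> 2 powr (n + t')" by (simp only: y)
      ultimately show "m \<in> A \<inter> {1..nat \<lfloor>?y\<rfloor>}"
        using m elim(1) unfolding A_def by auto
    qed
    then have "card {nat \<lfloor>?y * (1 - c)\<rfloor><..nat \<lfloor>?y\<rfloor>} \<le> card (A \<inter> {1..nat \<lfloor>?y\<rfloor>})"
      by (intro card_mono) auto
    then have 1: "real (nat \<lfloor>?y\<rfloor> - nat \<lfloor>?y * (1 - c)\<rfloor>) \<le> density_upto A ?y * ?y"
      by (simp add: density_upto_mult)
    have "0 \<le> ?y * (1 - c)" unfolding z by simp
    then have 2: "?y - 1 - ?y * (1 - c) \<le> real (nat \<lfloor>?y\<rfloor> - nat \<lfloor>?y * (1 - c)\<rfloor>)"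
      by linarith
    have "1 \<le> c / 2 * ?y" using elim(2) c by (simp add: field_simps)
    then have "c / 2 * ?y \<le> ?y - 1 - ?y * (1 - c)" by (simp add: algebra_simps)
    also note 2
    also note 1
    finally have "c / 2 * ?y \<le> density_upto A ?y * ?y" .
    then show ?case by (rule mult_right_le_imp_le) simp
  qed
  then have "c / 2 \<le> nu \<eta>' A"
    by (rule tendsto_lowerbound[OF nu_tendsto[OF p'(1) less_imp_le[OF p'(2)] p'(3), folded \<eta>']
          _ ultra_neq_bot])
  then show False using null c by linarith
qed

theorem theorem3p7:
  fixes \<eta> \<eta>' :: Omega
  shows "nu \<eta>' \<prec> nu \<eta> \<longleftrightarrow> \<eta>' \<in> closure (backward_orbit \<eta>)"
  using weakly_abs_cont_if_closure closure_if_weakly_abs_cont by blast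

end
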